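(* Let $n\ge 2$, let $m_0$ and $d$ be positive integers, and let $m_i=m_0+id$ for $0\le i\le n$ be an arithmetic sequence with $\gcd(m_0,\ldots,m_n)=1$ that minimally generates the numerical semigroup $\sum_{i=0}^n\mathbb{N}_0 m_i$. Write $m_0=qn+r$ with integers $q,r$ and $1\le r\le n$. Let $F$ be a field, let $P\subseteq F[x_0,\ldots,x_n]$ be the defining ideal corresponding to $m_0,\ldots,m_n$, and let $\mathrm{in}P$ be its initial ideal with respect to the weighted grevlex order described in the context. Let $l$ be any positive integer. Then $(\mathrm{in}P)^l$ is integrally closed if and only if $q\le 2$ and $r=1$. In particular, $\mathrm{in}P$ is normal if and only if $q\le 2$ and $r=1$.
   Context: $P$ is the kernel of the $F$-algebra homomorphism $\eta:F[x_0,\ldots,x_n]\to F[t]$, $\eta(x_i)=t^{m_i}$. Here $\mathbb{N}_0=\mathbb{N}\cup\{0\}$. The monomial order is grevlex with the grading $wt(x_i)=m_i$ and $x_0<x_1<\cdots<x_n$: monomials are first compared by weighted degree, and for two monomials of equal weighted degree $\prod_{i=0}^n x_i^{a_i}>\prod_{i=0}^n x_i^{b_i}$ if the left-most nonzero entry of $(a_0-b_0,a_1-b_1,\ldots,a_n-b_n)$ is negative. $\mathrm{in}P$ is the ideal generated by the leading monomials of the nonzero elements of $P$. The integral closure $\overline{I}$ of an ideal $I$ of a Noetherian ring $R$ is the set of $z\in R$ satisfying an equation $z^N+c_1z^{N-1}+\cdots+c_N=0$ with $c_i\in I^i$; $I$ is integrally closed if $I=\overline{I}$, and $I$ is normal if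 all its positive powers are integrally closed. *)

theory Defs
  imports
    "HOL-Library.Poly_Mapping"
    "HOL-Computational_Algebra.Polynomial"
    "HOL-Algebra.Ideal_Product"
begin

section \<open>The polynomial ring\<close>

text \<open>
  A monomial \<open>x\<^sub>0\<^bsup>a 0\<^esup> x\<^sub>1\<^bsup>a 1\<^esup> \<cdots>\<close> is represented by its finitely supported exponent vector, and a
  polynomial by the finitely supported function mapping each monomial to its coefficient.
  All polynomials live in one type with variables indexed by \<^typ>\<open>nat\<close>; the carrier cuts out
  those in the variables \<open>x\<^sub>0, \<dots>, x\<^sub>n\<close>.
\<close>

type_synonym monomial = "nat \<Rightarrow>\<^sub>0 nat"
type_synonym 'a mpoly = "monomial \<Rightarrow>\<^sub>0 'a"

definition mpoly_ring :: "nat \<Rightarrow> 'a::field mpoly ring" where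
  "mpoly_ring n =
     \<lparr>carrier = {p. \<forall>u \<in> Poly_Mapping.keys p. Poly_Mapping.keys u \<subseteq> {0..n}},
      monoid.mult = (*), one = 1, zero = 0, add = (+)\<rparr>"

definition monomial_poly :: "monomial \<Rightarrow> 'a::field mpoly" where
  "monomial_poly u = Poly_Mapping.single u 1"

lemma cring_mpoly_ring: "cring (mpoly_ring n :: 'a::field mpoly ring)"
proof -
  define C where "C = {p :: 'a mpoly. \<forall>u \<in> Poly_Mapping.keys p. Poly_Mapping.keys u \<subseteq> {0..n}}"
  have R: "mpoly_ring n = \<lparr>carrier = C, monoid.mult = (*), one = 1, zero = 0, add = (+)\<rparr>"
    by (simp add: mpoly_ring_def C_def)
  have plus: "p + q \<in> C" if "p \<in> C" "q \<in> C" for p q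
    using that Poly_Mapping.keys_add[of p q] unfolding C_def by blast
  have times: "p * q \<in> C" if pq: "p \<in> C" "q \<in> C" for p q
    unfolding C_def
  proof (clarify, rule ccontr)
    fix u i assume u: "u \<in> Poly_Mapping.keys (p * q)"
      and i: "i \<in> Poly_Mapping.keys u" "i \<notin> {0..n}"
    obtain a b where "u = a + b" "a \<in> Poly_Mapping.keys p" "b \<in> Poly_Mapping.keys q"
      using u keys_mult[of p q] by blast
    then show False
      using i pq Poly_Mapping.keys_add[of a b] unfolding C_def by blast
  qed
  have uminus: "- p \<in> C" if "p \<in> C" for p
    using that by (simp add: C_def keys.rep_eq)
  have zero: "0 \<in> C" and one: "1 \<in> C" by (simp_all add: C_def)
  show ?thesis
    unfolding R
  proof (rule cringI)
    show "abelian_group \<lparr>carrier = C, monoid.mult = (*), one = 1, zero = 0, add = (+)\<rparr>"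
    proof (rule abelian_groupI, goal_cases)
      case (6 x)
      then show ?case by (intro bexI[of _ "- x"]) (simp_all add: uminus)
    qed (simp_all add: plus zero add.assoc add.commute)
    show "comm_monoid \<lparr>carrier = C, monoid.mult = (*), one = 1, zero = 0, add = (+)\<rparr>"
      by (rule comm_monoidI) (simp_all add: times one mult.assoc mult.commute)
  qed (simp add: distrib_right)
qed


section \<open>The defining ideal\<close>

text \<open>\<open>param_hom m\<close> is evaluation at \<open>x\<^sub>i = t\<^bsup>m i\<^esup>\<close>; the lemmas below confirm that it is the
  homomorphism of algebras determined by these values.\<close>

definition param_hom :: "(nat \<Rightarrow> nat) \<Rightarrow> 'a::field mpoly \<Rightarrow> 'a poly" where
  "param_hom m p =
     (\<Sum>u \<in> Poly_Mapping.keys p. smult (Poly_Mapping.lookup p u)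
        (\<Prod>i \<in> Poly_Mapping.keys u. (monom 1 (m i)) ^ Poly_Mapping.lookup u i))"

definition defining_ideal :: "nat \<Rightarrow> (nat \<Rightarrow> nat) \<Rightarrow> 'a::field mpoly set" where
  "defining_ideal n m = {p \<in> carrier (mpoly_ring n). param_hom m p = 0}"

definition wdeg :: "(nat \<Rightarrow> nat) \<Rightarrow> monomial \<Rightarrow> nat" where
  "wdeg m u = (\<Sum>i \<in> Poly_Mapping.keys u. Poly_Mapping.lookup u i * m i)"

lemma wdeg_superset:
  assumes "finite A" "Poly_Mapping.keys u \<subseteq> A"
  shows "wdeg m u = (\<Sum>i \<in> A. Poly_Mapping.lookup u i * m i)"
  unfolding wdeg_def using assms
  by (intro sum.mono_neutral_left) (auto simp: in_keys_iff)

lemma wdeg_add: "wdeg m (u + v) = wdeg m u + wdeg m v"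
  using wdeg_superset[of "Poly_Mapping.keys u \<union> Poly_Mapping.keys v"]
    Poly_Mapping.keys_add[of u v]
  by (simp add: lookup_add algebra_simps sum.distrib)

lemma param_hom_superset:
  assumes "finite A" "Poly_Mapping.keys p \<subseteq> A"
  shows "param_hom m p = (\<Sum>u \<in> A. monom (Poly_Mapping.lookup p u) (wdeg m u))"
proof -
  have prod: "(\<Prod>i\<in>B. monom (1::'a) (k i)) = monom 1 (\<Sum>i\<in>B. k i)"
    for B :: "nat set" and k
    by (induction B rule: infinite_finite_induct) (auto simp: mult_monom)
  have "param_hom m p
      = (\<Sum>u \<in> Poly_Mapping.keys p. monom (Poly_Mapping.lookup p u) (wdeg m u))"
    by (simp add: param_hom_def wdeg_def monom_power prod smult_monom mult.commute)
  also have "\<dots> = (\<Sum>u \<in> A. monom (Poly_Mapping.lookup p u) (wdeg m u))"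
    using assms by (intro sum.mono_neutral_left) (auto simp: in_keys_iff)
  finally show ?thesis .
qed

lemma param_hom_add: "param_hom m (p + q) = param_hom m p + param_hom m q"
proof -
  let ?A = "Poly_Mapping.keys p \<union> Poly_Mapping.keys q"
  have "param_hom m s = (\<Sum>u \<in> ?A. monom (Poly_Mapping.lookup s u) (wdeg m u))"
    if "s \<in> {p, q, p + q}" for s
    using that Poly_Mapping.keys_add[of p q] by (intro param_hom_superset) auto
  then show ?thesis
    by (simp add: lookup_add sum.distrib flip: add_monom)
qed

lemma param_hom_single: "param_hom m (Poly_Mapping.single u c) = monom c (wdeg m u)"
  by (subst param_hom_superset[of "{u}"]) auto

lemma param_hom_const: "param_hom m (Poly_Mapping.single 0 c) = [:c:]"
  by (simp add: param_hom_single wdeg_def monom_0)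

lemma param_hom_var: "param_hom m (monomial_poly (Poly_Mapping.single i 1)) = monom 1 (m i)"
  by (simp add: monomial_poly_def param_hom_single wdeg_def)

lemma poly_mapping_single_add_induct [case_names zero add]:
  assumes "Q 0" and "\<And>f u c. Q f \<Longrightarrow> Q (Poly_Mapping.single u c + f)"
  shows "Q (p :: 'b \<Rightarrow>\<^sub>0 'a::comm_monoid_add)"
proof (induction p rule: Poly_Mapping.update_induct)
  case const
  then show ?case by (rule assms(1))
next
  case (update f a b)
  have "Poly_Mapping.update a b f = Poly_Mapping.single a b + f"
    using update by (intro poly_mapping_eqI)
      (auto simp: lookup_update lookup_add lookup_single in_keys_iff when_def)
  then show ?case using assms(2) update by simp
qed

lemma param_hom_mult: "param_hom m (p * q) = param_hom m p * param_hom m q"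
proof -
  have zero: "param_hom m 0 = 0"
    by (simp add: param_hom_def)
  have "param_hom m (Poly_Mapping.single u c * q)
      = monom c (wdeg m u) * param_hom m q" for u c
  proof (induction q rule: poly_mapping_single_add_induct)
    case (add f v d)
    then show ?case
      by (simp add: distrib_left param_hom_add mult_single param_hom_single wdeg_add mult_monom)
  qed (simp add: zero)
  then show ?thesis
    by (induction p rule: poly_mapping_single_add_induct)
      (simp_all add: zero param_hom_single param_hom_add distrib_right)
qed


section \<open>The initial ideal\<close>

text \<open>In case of equal weighted degrees, the first index at which \<open>v - u\<close> is nonzero must carry a
  negative entry for \<open>v\<close> to be the larger monomial.\<close>

definition grevlex_less :: "(nat \<Rightarrow> nat) \<Rightarrow> monomial \<Rightarrow> monomial \<Rightarrow> bool" where
  "grevlex_less m u v \<longleftrightarrow>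
     wdeg m u < wdeg m v \<or>
     wdeg m u = wdeg m v \<and>
       (\<exists>i. (\<forall>j<i. Poly_Mapping.lookup v j = Poly_Mapping.lookup u j) \<and>
            Poly_Mapping.lookup v i < Poly_Mapping.lookup u i)"

definition is_leading_monomial ::
    "(nat \<Rightarrow> nat) \<Rightarrow> 'a::field mpoly \<Rightarrow> monomial \<Rightarrow> bool" where
  "is_leading_monomial m p u \<longleftrightarrow>
     u \<in> Poly_Mapping.keys p \<and>
     (\<forall>v \<in> Poly_Mapping.keys p. v \<noteq> u \<longrightarrow> grevlex_less m v u)"

definition initial_ideal ::
    "nat \<Rightarrow> (nat \<Rightarrow> nat) \<Rightarrow> 'a::field mpoly set \<Rightarrow> 'a mpoly set" where
  "initial_ideal n m I =
     Idl\<^bsub>mpoly_ring n\<^esub> {monomial_poly u |u. \<exists>p \<in> I. p \<noteq> 0 \<and> is_leading_monomial m p u}"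


section \<open>Integrally closed and normal ideals\<close>

abbreviation ideal_power :: "('a, 'b) ring_scheme \<Rightarrow> 'a set \<Rightarrow> nat \<Rightarrow> 'a set" where
  "ideal_power R I k \<equiv> I [^]\<^bsub>ideals_set R\<^esub> k"

definition integral_closure :: "('a, 'b) ring_scheme \<Rightarrow> 'a set \<Rightarrow> 'a set" where
  "integral_closure R I =
     {z \<in> carrier R. \<exists>N::nat. \<exists>c. N \<ge> 1 \<and>
        (\<forall>i \<in> {1..N}. c i \<in> ideal_power R I i) \<and>
        z [^]\<^bsub>R\<^esub> N \<oplus>\<^bsub>R\<^esub> (\<Oplus>\<^bsub>R\<^esub>i \<in> {1..N}. c i \<otimes>\<^bsub>R\<^esub> z [^]\<^bsub>R\<^esub> (N - i)) = \<zero>\<^bsub>R\<^esub>}"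

definition integrally_closed :: "('a, 'b) ring_scheme \<Rightarrow> 'a set \<Rightarrow> bool" where
  "integrally_closed R I \<longleftrightarrow> integral_closure R I = I"

definition normal_ideal :: "('a, 'b) ring_scheme \<Rightarrow> 'a set \<Rightarrow> bool" where
  "normal_ideal R I \<longleftrightarrow> (\<forall>k\<ge>1. integrally_closed R (ideal_power R I k))"


section \<open>Numerical semigroups\<close>

definition generated_semigroup :: "(nat \<Rightarrow> nat) \<Rightarrow> nat set \<Rightarrow> nat set" where
  "generated_semigroup m J = range (\<lambda>a. \<Sum>i\<in>J. a i * m i)"

definition minimally_generates :: "(nat \<Rightarrow> nat) \<Rightarrow> nat \<Rightarrow> bool" where
  "minimally_generates m n \<longleftrightarrow>
     (\<forall>J. J \<subset> {0..n} \<longrightarrow> generated_semigroup m J \<noteq> generated_semigroup m {0..n})"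

end

theory Submission
  imports Defs "HOL-Library.Set_Algebras" "HOL-Number_Theory.Cong"
begin

text \<open>
  The initial ideal can be written down: with \<open>q\<close> and \<open>r\<close> natural numbers it is
  \<open>M = (x\<^sub>i x\<^sub>j : 1 \<le> i, j < n) + (x\<^sub>n\<^bsup>q\<^esup> x\<^sub>j : r \<le> j \<le> n)\<close>.
  Each of these generators is the leading monomial of a binomial of \<open>P\<close>
  (\<open>generator_reduces\<close>). Conversely, the monomials outside \<open>M\<close> are
  \<open>x\<^sub>0\<^bsup>a\<^esup> x\<^sub>n\<^bsup>b\<^esup> x\<^sub>j\<close> with \<open>b n + j < m\<^sub>0\<close> (\<open>x\<^sub>j\<close> absent for \<open>j = 0\<close>), and no two of them have
  the same weighted degree, because \<open>m\<^sub>0\<close> and \<open>d\<close> are coprime (\<open>standard_unique\<close>). So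
  among the monomials of a given weighted degree exactly one lies outside \<open>M\<close>, the least one
  in the grevlex order. The leading monomial of an element of \<open>P\<close> is never least in its degree,
  since the coefficients belonging to one degree add up to zero. This gives \<open>initial_ideal_eq\<close>.

  Suppose \<open>q > 2\<close> or \<open>r > 1\<close>. Put \<open>k = q\<close> if \<open>r > 1\<close> and \<open>k = q - 1\<close> if \<open>r = 1\<close>. Among the
  monomials of \<open>M\<close> in \<open>x\<^sub>1\<close> and \<open>x\<^sub>n\<close>, those not divisible by \<open>x\<^sub>1\<^sup>2\<close> are divisible by
  \<open>x\<^sub>n\<^bsup>k+1\<^esup>\<close>, so \<open>z = x\<^sub>1\<^bsup>2l-1\<^esup> x\<^sub>n\<^bsup>k\<^esup>\<close> is not in \<open>M\<^sup>l\<close>. But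
  \<open>z\<^sup>2 = x\<^sub>1\<^bsup>2l\<^esup> \<cdot> (x\<^sub>1\<^bsup>2l-2\<^esup> x\<^sub>n\<^bsup>2k\<^esup>)\<close> is in \<open>M\<^bsup>2l\<^esup>\<close>, as \<open>2 k \<ge> q + 1\<close>; hence
  \<open>z\<close> is integral over \<open>M\<^sup>l\<close> (\<open>powers_not_integrally_closed\<close>).

  Suppose \<open>q \<le> 2\<close> and \<open>r = 1\<close>. The Newton polyhedron of \<open>M\<close> then has a single facet
  outside the coordinate hyperplanes, and every lattice point in it belongs to \<open>M\<close>: give \<open>x\<^sub>1, \<dots>, x\<^bsub>n-1\<^esub>\<close> the weight \<open>q + 1\<close>, \<open>x\<^sub>n\<close> the weight \<open>2\<close> and \<open>x\<^sub>0\<close> the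
  weight \<open>0\<close>; then \<open>M\<^sup>l\<close> is spanned by the monomials of weight at least \<open>2 (q + 1) l\<close>
  (\<open>upset_power_eq_weight\<close>). Such an ideal is integrally closed, because the least weight
  occurring in a polynomial is a valuation (\<open>integrally_closed_weight_ideal\<close>).
\<close>

section \<open>Monomial ideals\<close>

abbreviation support :: "'a::field mpoly \<Rightarrow> monomial set" where
  "support \<equiv> Poly_Mapping.keys"

abbreviation expo :: "monomial \<Rightarrow> nat \<Rightarrow> nat" where
  "expo \<equiv> Poly_Mapping.lookup"

abbreviation var :: "nat \<Rightarrow> monomial" where
  "var i \<equiv> Poly_Mapping.single i 1"

definition monomials :: "nat \<Rightarrow> monomial set" where
  "monomials n = {u. Poly_Mapping.keys u \<subseteq> {0..n}}"

text \<open>A monomial ideal is the span of the monomials that it contains, and these form an up-closed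
  set in \<open>monomials n\<close>. Computing with monomial ideals thus becomes computing with up-closed
  sets, whose elementwise sum \<open>S + T\<close> corresponds to the product of ideals.\<close>

definition monomial_span :: "monomial set \<Rightarrow> 'a::field mpoly set" where
  "monomial_span S = {p. support p \<subseteq> S}"

definition upset :: "nat \<Rightarrow> monomial set \<Rightarrow> bool" where
  "upset n S \<longleftrightarrow> S \<subseteq> monomials n \<and> S + monomials n \<subseteq> S"

text \<open>The start value is the up-closed set of the unit ideal, which is the zeroth power of an ideal.\<close>

primrec upset_power :: "nat \<Rightarrow> monomial set \<Rightarrow> nat \<Rightarrow> monomial set" where
  "upset_power n S 0 = monomials n"
| "upset_power n S (Suc k) = upset_power n S k + S"

lemma monomials_iff: "u \<in> monomials n \<longleftrightarrow> (\<forall>i>n. expo u i = 0)"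
  by (auto simp: monomials_def subset_iff in_keys_iff simp flip: not_less)

lemma zero_in_monomials: "0 \<in> monomials n"
  by (simp add: monomials_iff)

lemma monomials_add_iff: "u + v \<in> monomials n \<longleftrightarrow> u \<in> monomials n \<and> v \<in> monomials n"
  by (auto simp: monomials_iff lookup_add)

lemma var_in_monomials: "i \<le> n \<Longrightarrow> Poly_Mapping.single i k \<in> monomials n"
  by (auto simp: monomials_iff lookup_single when_def)

lemma upset_monomials: "upset n (monomials n)"
  by (auto simp: upset_def monomials_add_iff elim!: set_plus_elim)

lemma upset_generated:
  assumes "G \<subseteq> monomials n" shows "upset n (G + monomials n)"
proof -
  have "monomials n + monomials n \<subseteq> monomials n"
    using upset_monomials upset_def by blast
  then have "G + (monomials n + monomials n) \<subseteq> G + monomials n"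
    by (intro set_plus_mono2) auto
  moreover have "G + monomials n \<subseteq> monomials n"
    using assms by (auto simp: monomials_add_iff elim!: set_plus_elim)
  ultimately show ?thesis
    by (simp add: upset_def add.assoc)
qed

lemma upset_add_absorb:
  assumes "upset n S" shows "S + monomials n = S"
proof
  show "S \<subseteq> S + monomials n"
    using zero_in_monomials set_plus_intro[of _ S 0 "monomials n"] by fastforce
qed (use assms in \<open>simp add: upset_def\<close>)

lemma upset_plus:
  assumes "upset n S" "upset n T" shows "upset n (S + T)"
proof -
  have "S + T + monomials n = S + T"
    using assms(2) by (simp add: add.assoc upset_add_absorb)
  moreover have "S + T \<subseteq> monomials n"
    using assms by (auto simp: upset_def monomials_add_iff elim!: set_plus_elim)
  ultimately show ?thesis by (simp add: upset_def)
qed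

lemma upset_power_upset: "upset n S \<Longrightarrow> upset n (upset_power n S k)"
  by (induction k) (auto simp: upset_monomials upset_plus)

lemma monomial_span_plus: "p \<in> monomial_span S \<Longrightarrow> q \<in> monomial_span S \<Longrightarrow> p + q \<in> monomial_span S"
  using Poly_Mapping.keys_add[of p q] by (auto simp: monomial_span_def)

lemma monomial_span_zero: "0 \<in> monomial_span S"
  by (simp add: monomial_span_def)

lemma monomial_span_uminus: "p \<in> monomial_span S \<Longrightarrow> - p \<in> monomial_span S"
  by (simp add: monomial_span_def keys.rep_eq)

lemma monomial_span_diff: "p \<in> monomial_span S \<Longrightarrow> q \<in> monomial_span S \<Longrightarrow> p - q \<in> monomial_span S"
  using monomial_span_plus[of p S "- q"] monomial_span_uminus[of q S] by simp

lemma monomial_span_times: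
  "p \<in> monomial_span S \<Longrightarrow> q \<in> monomial_span T \<Longrightarrow> p * q \<in> monomial_span (S + T)"
  using keys_mult[of p q] by (fastforce simp: monomial_span_def)

lemma monomial_span_single: "u \<in> S \<Longrightarrow> Poly_Mapping.single u c \<in> monomial_span S"
  by (simp add: monomial_span_def)

lemma monomial_span_mono: "S \<subseteq> T \<Longrightarrow> p \<in> monomial_span S \<Longrightarrow> p \<in> monomial_span T"
  by (auto simp: monomial_span_def)

lemma monomial_span_sum:
  "(\<And>i. i \<in> A \<Longrightarrow> f i \<in> monomial_span S) \<Longrightarrow> sum f A \<in> monomial_span S"
  by (induction A rule: infinite_finite_induct) (auto simp: monomial_span_plus monomial_span_zero)

lemma sum_of_terms: "(\<Sum>u\<in>support p. Poly_Mapping.single u (Poly_Mapping.lookup p u)) = p"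
proof (rule poly_mapping_eqI)
  fix v
  have "Poly_Mapping.lookup (\<Sum>u\<in>support p. Poly_Mapping.single u (Poly_Mapping.lookup p u)) v
      = (\<Sum>u\<in>support p. if u = v then Poly_Mapping.lookup p u else 0)"
    by (simp add: lookup_sum lookup_single when_def)
  then show "Poly_Mapping.lookup (\<Sum>u\<in>support p. Poly_Mapping.single u (Poly_Mapping.lookup p u)) v
      = Poly_Mapping.lookup p v"
    by (simp add: sum.delta in_keys_iff)
qed

text \<open>The induction principle for spans: a polynomial is the sum of its terms, so a set closed under
  addition contains the span as soon as it contains the terms.\<close>

lemma monomial_span_least:
  fixes A :: "'a::field mpoly set"
  assumes "\<And>u c. u \<in> S \<Longrightarrow> Poly_Mapping.single u c \<in> A" "0 \<in> A"
    and "\<And>p q. p \<in> A \<Longrightarrow> q \<in> A \<Longrightarrow> p + q \<in> A"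
  shows "monomial_span S \<subseteq> A"
proof
  fix p :: "'a mpoly" assume p: "p \<in> monomial_span S"
  have "(\<Sum>u\<in>B. Poly_Mapping.single u (Poly_Mapping.lookup p u)) \<in> A" if "B \<subseteq> S" for B
    using that by (induction B rule: infinite_finite_induct) (auto simp: assms)
  from this[of "support p"] show "p \<in> A"
    using p by (simp add: sum_of_terms monomial_span_def)
qed

lemma mpoly_ring_simps [simp]:
  "carrier (mpoly_ring n) = monomial_span (monomials n)"
  "p \<otimes>\<^bsub>mpoly_ring n\<^esub> p' = p * p'" "\<one>\<^bsub>mpoly_ring n\<^esub> = 1"
  "\<zero>\<^bsub>mpoly_ring n\<^esub> = 0" "p \<oplus>\<^bsub>mpoly_ring n\<^esub> p' = p + p'"
  by (auto simp: mpoly_ring_def monomial_span_def monomials_def)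

lemma mpoly_ring_pow [simp]: "p [^]\<^bsub>mpoly_ring n\<^esub> (k::nat) = p ^ k"
  by (induction k) (auto simp: nat_pow_def mult.commute)

lemma mpoly_ring_finsum:
  assumes "finite A" "\<And>i. i \<in> A \<Longrightarrow> f i \<in> monomial_span (monomials n)"
  shows "(\<Oplus>\<^bsub>mpoly_ring n\<^esub>i\<in>A. f i) = sum f A"
proof -
  interpret cring "mpoly_ring n" by (rule cring_mpoly_ring)
  show ?thesis
    using assms by (induction A rule: finite_induct) (simp_all add: finsum_insert Pi_def)
qed

lemma monomial_span_ideal:
  assumes "upset n S"
  shows "ideal (monomial_span S :: 'a::field mpoly set) (mpoly_ring n)"
proof -
  interpret cring "mpoly_ring n :: 'a mpoly ring" by (rule cring_mpoly_ring)
  have sub: "S \<subseteq> monomials n" and abs: "S + monomials n = S" "monomials n + S = S"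
    using assms upset_add_absorb[OF assms] by (simp_all add: upset_def add.commute)
  show ?thesis
  proof (rule idealI)
    show "ring (mpoly_ring n :: 'a mpoly ring)" by (rule ring_axioms)
    show "subgroup (monomial_span S :: 'a mpoly set) (add_monoid (mpoly_ring n))"
    proof (rule add.subgroupI)
      show "monomial_span S \<subseteq> carrier (mpoly_ring n :: 'a mpoly ring)"
        using sub by (auto simp: monomial_span_def)
      show "monomial_span S \<noteq> ({} :: 'a mpoly set)"
        using monomial_span_zero by blast
      fix p :: "'a mpoly" assume p: "p \<in> monomial_span S"
      then have "p \<in> monomial_span (monomials n)"
        using sub monomial_span_mono by blast
      then have "\<ominus>\<^bsub>mpoly_ring n\<^esub> p = - p"
        by (intro minus_equality) (auto simp: monomial_span_uminus)
      then show "\<ominus>\<^bsub>mpoly_ring n\<^esub> p \<in> monomial_span S"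
        using p by (simp add: monomial_span_uminus)
    qed (simp add: monomial_span_plus)
  next
    fix p x :: "'a mpoly"
    assume "p \<in> monomial_span S" "x \<in> carrier (mpoly_ring n)"
    then have "p * x \<in> monomial_span (S + monomials n)" by (simp add: monomial_span_times)
    then show "x \<otimes>\<^bsub>mpoly_ring n\<^esub> p \<in> monomial_span S" "p \<otimes>\<^bsub>mpoly_ring n\<^esub> x \<in> monomial_span S"
      by (simp_all add: abs mult.commute)
  qed
qed

text \<open>The span is an ideal, and every term in it is a generator times a term, so it is the smallest
  ideal containing the generators.\<close>

lemma ideal_generated_by_monomials:
  assumes "G \<subseteq> monomials n"
  shows "Idl\<^bsub>mpoly_ring n\<^esub> {monomial_poly u |u. u \<in> G} =
    (monomial_span (G + monomials n) :: 'a::field mpoly set)"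
    (is "?I = _")
proof
  interpret cring "mpoly_ring n :: 'a mpoly ring" by (rule cring_mpoly_ring)
  have gens: "{monomial_poly u |u. u \<in> G} \<subseteq> (monomial_span (G + monomials n) :: 'a mpoly set)"
    using set_plus_intro[of _ G 0 "monomials n"] zero_in_monomials
    by (fastforce simp: monomial_poly_def intro!: monomial_span_single)
  then show "?I \<subseteq> monomial_span (G + monomials n)"
    by (intro genideal_minimal monomial_span_ideal upset_generated assms)
  have carr: "{monomial_poly u |u. u \<in> G} \<subseteq> carrier (mpoly_ring n :: 'a mpoly ring)"
    using assms by (auto simp: monomial_poly_def intro!: monomial_span_single)
  interpret I: ideal ?I "mpoly_ring n"
    by (rule genideal_ideal[OF carr])
  show "monomial_span (G + monomials n) \<subseteq> ?I"
  proof (rule monomial_span_least)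
    fix u :: monomial and c :: 'a assume "u \<in> G + monomials n"
    then obtain g v where u: "u = g + v" "g \<in> G" "v \<in> monomials n"
      by (rule set_plus_elim)
    have "monomial_poly g \<in> ?I"
      using u genideal_self[OF carr] by blast
    moreover have "Poly_Mapping.single v c \<in> carrier (mpoly_ring n)"
      using u by (simp add: monomial_span_single)
    ultimately have "monomial_poly g \<otimes>\<^bsub>mpoly_ring n\<^esub> Poly_Mapping.single v c \<in> ?I"
      by (rule I.I_r_closed)
    then show "Poly_Mapping.single u c \<in> ?I"
      by (simp add: u monomial_poly_def mult_single)
  qed (use I.zero_closed I.a_closed in simp_all)
qed

lemma monomial_span_prod:
  "ideal_prod (mpoly_ring n) (monomial_span S) (monomial_span T)
     = (monomial_span (S + T) :: 'a::field mpoly set)"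
    (is "?I = _")
proof
  show "?I \<subseteq> monomial_span (S + T)"
  proof
    fix p assume "p \<in> ?I"
    then show "p \<in> monomial_span (S + T)"
      by induction (simp_all add: monomial_span_times monomial_span_plus)
  qed
  have prod: "p * q \<in> ?I" if "p \<in> monomial_span S" "q \<in> monomial_span T" for p q :: "'a mpoly"
    using ideal_prod.prod[OF that, of "mpoly_ring n"] by simp
  show "monomial_span (S + T) \<subseteq> ?I"
  proof (rule monomial_span_least)
    fix u :: monomial and c :: 'a assume "u \<in> S + T"
    then obtain g v where u: "u = g + v" "g \<in> S" "v \<in> T"
      by (rule set_plus_elim)
    then have "Poly_Mapping.single g 1 * Poly_Mapping.single v c \<in> ?I"
      by (intro prod monomial_span_single)
    then show "Poly_Mapping.single u c \<in> ?I"
      by (simp add: u mult_single)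
  next
    show "0 \<in> ?I" using prod[OF monomial_span_zero monomial_span_zero] by simp
  next
    fix p q assume "p \<in> ?I" "q \<in> ?I"
    then show "p + q \<in> ?I" using ideal_prod.sum[of p "mpoly_ring n"] by simp
  qed
qed

lemma monomial_span_power:
  "ideal_power (mpoly_ring n) (monomial_span S) k
     = (monomial_span (upset_power n S k) :: 'a::field mpoly set)"
proof (induction k)
  case 0
  then show ?case by (simp add: nat_pow_def ideals_set_def)
next
  case (Suc k)
  have "ideal_power (mpoly_ring n) (monomial_span S :: 'a mpoly set) (Suc k)
      = ideal_prod (mpoly_ring n) (ideal_power (mpoly_ring n) (monomial_span S) k) (monomial_span S)"
    by (simp add: nat_pow_def ideals_set_def)
  then show ?case using Suc by (simp add: monomial_span_prod)
qed

section \<open>Integral closure of monomial ideals\<close>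

text \<open>Each \<open>z\<close> in the ideal satisfies the equation \<open>z + c\<^sub>1 = 0\<close> with \<open>c\<^sub>1 = - z\<close>.\<close>

lemma monomial_span_le_integral_closure:
  assumes "upset n S"
  shows "monomial_span S \<subseteq> integral_closure (mpoly_ring n) (monomial_span S :: 'a::field mpoly set)"
proof
  fix z :: "'a mpoly" assume z: "z \<in> monomial_span S"
  have zn: "z \<in> monomial_span (monomials n)"
    using z assms monomial_span_mono unfolding upset_def by blast
  have "monomials n + S = S"
    using upset_add_absorb[OF assms] by (simp add: add.commute)
  then have "\<forall>i\<in>{1..1::nat}. - z \<in> ideal_power (mpoly_ring n) (monomial_span S) i"
    unfolding monomial_span_power using z by (simp add: monomial_span_uminus)
  moreover have "(\<Oplus>\<^bsub>mpoly_ring n\<^esub>i\<in>{1..1::nat}. - z \<otimes>\<^bsub>mpoly_ring n\<^esub> z [^]\<^bsub>mpoly_ring n\<^esub> (1 - i)) = - z"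
    using zn by (subst mpoly_ring_finsum) (auto simp: monomial_span_uminus)
  ultimately show "z \<in> integral_closure (mpoly_ring n) (monomial_span S)"
    unfolding integral_closure_def using zn
    by (auto intro!: exI[of _ "1::nat"] exI[of _ "\<lambda>_. - z"])
qed

text \<open>A monomial \<open>z\<close> whose square lies in the square of the ideal satisfies \<open>z\<^sup>2 + c\<^sub>2 = 0\<close> with
  \<open>c\<^sub>2 = - z\<^sup>2\<close>.\<close>

lemma monomial_in_integral_closure:
  assumes S: "upset n S" and u: "u \<in> monomials n" "u + u \<in> S + S"
  shows "monomial_poly u \<in> integral_closure (mpoly_ring n) (monomial_span S :: 'a::field mpoly set)"
proof -
  let ?z = "monomial_poly u :: 'a mpoly"
  let ?c = "\<lambda>i::nat. if i = 2 then - (?z ^ 2) else 0"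
  have zz: "?z ^ 2 = Poly_Mapping.single (u + u) 1"
    by (simp add: monomial_poly_def mult_single power2_eq_square)
  have "monomials n + S = S"
    using upset_add_absorb[OF S] by (simp add: add.commute)
  then have "upset_power n S 2 = S + S"
    by (simp add: numeral_2_eq_2)
  then have "?z ^ 2 \<in> monomial_span (upset_power n S 2)"
    using u by (simp add: zz monomial_span_single)
  then have c: "\<forall>i\<in>{1..2}. ?c i \<in> ideal_power (mpoly_ring n) (monomial_span S) i"
    unfolding monomial_span_power by (simp add: monomial_span_uminus monomial_span_zero)
  have u2: "?z ^ 2 \<in> monomial_span (monomials n)"
    using u by (simp add: zz monomial_span_single monomials_add_iff)
  have "{1..2::nat} = {1, 2}" by auto
  then have "(\<Oplus>\<^bsub>mpoly_ring n\<^esub>i\<in>{1..2}. ?c i \<otimes>\<^bsub>mpoly_ring n\<^esub> ?z [^]\<^bsub>mpoly_ring n\<^esub> (2 - i))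
      = - (?z ^ 2)"
    using u2 by (subst mpoly_ring_finsum) (auto simp: monomial_span_uminus monomial_span_zero)
  moreover have "?z \<in> monomial_span (monomials n)"
    using u by (simp add: monomial_poly_def monomial_span_single)
  ultimately show ?thesis
    unfolding integral_closure_def using c
    by (auto intro!: exI[of _ "2::nat"] exI[of _ ?c])
qed

text \<open>The initial form \<open>z0\<close> of \<open>z\<close> collects the terms of least weight \<open>e\<close>.\<close>

lemma weight_initial_form:
  fixes w :: "monomial \<Rightarrow> nat" and z :: "'a::field mpoly"
  assumes "u \<in> support z" "w u < k"
  obtains e z0 where "e < k" "z0 \<noteq> 0" "z0 \<in> monomial_span {v. w v = e}"
    "z \<in> monomial_span {v. e \<le> w v}" "z - z0 \<in> monomial_span {v. e < w v}"
proof -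
  define e where "e = Min (w ` support z)"
  have le: "e \<le> w v" if "v \<in> support z" for v
    using that by (simp add: e_def)
  have "e \<in> w ` support z" unfolding e_def using assms(1) by (intro Min_in) auto
  then obtain u0 where u0: "u0 \<in> support z" "w u0 = e" by auto
  define z0 where "z0 = Poly_Mapping.mapp (\<lambda>v c. if w v = e then c else 0) z"
  have lookup: "Poly_Mapping.lookup z0 v = (if w v = e then Poly_Mapping.lookup z v else 0)" for v
    by (simp add: z0_def lookup_mapp when_def in_keys_iff)
  show ?thesis
  proof (rule that)
    show "e < k" using le[OF assms(1)] assms(2) by simp
    show "z0 \<noteq> 0" using u0 lookup[of u0] by (auto simp: in_keys_iff)
    show "z0 \<in> monomial_span {v. w v = e}"
      by (auto simp: monomial_span_def in_keys_iff lookup split: if_splits)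
    show "z \<in> monomial_span {v. e \<le> w v}"
      using le by (auto simp: monomial_span_def)
    show "z - z0 \<in> monomial_span {v. e < w v}"
    proof -
      have "e < w v" if "v \<in> support (z - z0)" for v
        using that le[of v] by (cases "w v = e") (auto simp: in_keys_iff lookup lookup_minus)
      then show ?thesis by (auto simp: monomial_span_def)
    qed
  qed
qed

text \<open>If \<open>z\<close> had least weight \<open>e < k\<close>, then in an equation of integral dependence each
  \<open>c\<^sub>i z\<^bsup>N-i\<^esup>\<close> has weight at least \<open>i k + (N - i) e > N e\<close>, so all terms of \<open>z\<^sup>N\<close> of weight
  \<open>N e\<close> must cancel. But these form the \<open>N\<close>-th power of the initial form of \<open>z\<close>, which is
  nonzero because the polynomials form a domain.\<close>

lemma integrally_closed_weight_ideal:
  fixes w :: "monomial \<Rightarrow> nat" and k n :: nat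
  assumes add: "\<And>u v. w (u + v) = w u + w v"
  defines "S \<equiv> {u \<in> monomials n. k \<le> w u}"
  shows "integrally_closed (mpoly_ring n) (monomial_span S :: 'a::field mpoly set)"
proof -
  have times: "p * q \<in> monomial_span {v. a + b \<le> w v}"
    if "p \<in> monomial_span {v. a \<le> w v}" "q \<in> monomial_span {v. b \<le> w v}"
    for p q :: "'a mpoly" and a b
    using monomial_span_times[OF that]
    by (rule monomial_span_mono[rotated]) (auto simp: add elim!: set_plus_elim)
  have w0: "w 0 = 0" using add[of 0 0] by simp
  have powr: "p ^ j \<in> monomial_span {v. j * a \<le> w v}"
    if "p \<in> monomial_span {v. a \<le> w v}" for p :: "'a mpoly" and a j
  proof (induction j)
    case (Suc j)
    then show ?case using times[OF that Suc] by (simp add: add.commute)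
  qed (simp add: monomial_span_def)
  have upS: "upset n S"
    by (auto simp: upset_def S_def add monomials_add_iff elim!: set_plus_elim)
  have pow_weight: "upset_power n S i \<subseteq> {u \<in> monomials n. i * k \<le> w u}" for i
  proof (induction i)
    case (Suc i)
    then show ?case
      by (fastforce simp: S_def add monomials_add_iff elim!: set_plus_elim)
  qed auto
  have "z \<in> monomial_span S"
    if z: "z \<in> integral_closure (mpoly_ring n) (monomial_span S)" for z :: "'a mpoly"
  proof (rule ccontr)
    assume zS: "z \<notin> monomial_span S"
    have zn: "z \<in> monomial_span (monomials n)"
      using z by (simp add: integral_closure_def)
    obtain N :: nat and c where
      c': "\<forall>i\<in>{1..N}. c i \<in> monomial_span (upset_power n S i)"
      and eq: "z ^ N + (\<Oplus>\<^bsub>mpoly_ring n\<^esub>i\<in>{1..N}. c i * z ^ (N - i)) = 0"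
      using z unfolding integral_closure_def monomial_span_power mem_Collect_eq mpoly_ring_simps
        mpoly_ring_pow by (elim exE conjE) (rule that)
    have c: "c i \<in> monomial_span (upset_power n S i)" if "i \<in> {1..N}" for i
      using c' that by blast
    have cn: "c i * z ^ (N - i) \<in> monomial_span (monomials n)" if "i \<in> {1..N}" for i
    proof -
      interpret cring "mpoly_ring n :: 'a mpoly ring" by (rule cring_mpoly_ring)
      have "c i \<in> carrier (mpoly_ring n)"
        using c[OF that] pow_weight[of i] by (auto simp: monomial_span_def)
      moreover have "z [^]\<^bsub>mpoly_ring n\<^esub> (N - i) \<in> carrier (mpoly_ring n)"
        using zn by (intro nat_pow_closed) simp
      ultimately have "c i \<otimes>\<^bsub>mpoly_ring n\<^esub> z [^]\<^bsub>mpoly_ring n\<^esub> (N - i) \<in> carrier (mpoly_ring n)"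
        by (rule m_closed)
      then show ?thesis by simp
    qed
    have "(\<Oplus>\<^bsub>mpoly_ring n\<^esub>i\<in>{1..N}. c i * z ^ (N - i)) = (\<Sum>i\<in>{1..N}. c i * z ^ (N - i))"
      by (rule mpoly_ring_finsum[OF finite_atLeastAtMost cn])
    then have zN: "z ^ N = - (\<Sum>i\<in>{1..N}. c i * z ^ (N - i))"
      using eq by (simp only: eq_neg_iff_add_eq_0)
    obtain u where "u \<in> support z" "w u < k"
      using zS zn by (auto simp: monomial_span_def S_def simp flip: not_less)
    then obtain e z0 where e: "e < k" and z0: "z0 \<noteq> 0" "z0 \<in> monomial_span {v. w v = e}"
      and ze: "z \<in> monomial_span {v. e \<le> w v}" and diff: "z - z0 \<in> monomial_span {v. e < w v}"
      by (rule weight_initial_form)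
    have z0_le: "z0 \<in> monomial_span {v. e \<le> w v}"
      using z0(2) by (auto simp: monomial_span_def)
    have "z ^ N \<in> monomial_span {v. Suc (N * e) \<le> w v}"
      unfolding zN
    proof (intro monomial_span_uminus monomial_span_sum)
      fix i assume i: "i \<in> {1..N}"
      have "c i \<in> monomial_span {v. i * k \<le> w v}"
        using c[OF i] pow_weight[of i] by (auto simp: monomial_span_def)
      then have *: "c i * z ^ (N - i) \<in> monomial_span {v. i * k + (N - i) * e \<le> w v}"
        using times powr ze by blast
      have "N * e = i * e + (N - i) * e"
        using i by (simp flip: add_mult_distrib)
      moreover have "i * e < i * k" using i e by simp
      ultimately have "Suc (N * e) \<le> i * k + (N - i) * e" by linarith
      then show "c i * z ^ (N - i) \<in> monomial_span {v. Suc (N * e) \<le> w v}"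
        by (intro monomial_span_mono[OF _ *]) auto
    qed
    moreover have "z ^ j - z0 ^ j \<in> monomial_span {v. Suc (j * e) \<le> w v}" for j
    proof (induction j)
      case (Suc j)
      have "z ^ Suc j - z0 ^ Suc j = z * (z ^ j - z0 ^ j) + (z - z0) * z0 ^ j"
        by (simp add: algebra_simps)
      moreover have "z * (z ^ j - z0 ^ j) \<in> monomial_span {v. e + Suc (j * e) \<le> w v}"
        by (rule times[OF ze Suc])
      moreover have "(z - z0) * z0 ^ j \<in> monomial_span {v. Suc e + j * e \<le> w v}"
        using diff powr[OF z0_le] by (intro times) (simp_all add: Suc_le_eq)
      ultimately show ?case by (auto intro: monomial_span_plus)
    qed (simp add: monomial_span_zero)
    ultimately have "z ^ N - (z ^ N - z0 ^ N) \<in> monomial_span {v. Suc (N * e) \<le> w v}"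
      by (rule monomial_span_diff)
    then have high: "z0 ^ N \<in> monomial_span {v. Suc (N * e) \<le> w v}" by simp
    have low: "z0 ^ j \<in> monomial_span {v. w v = j * e}" for j
    proof (induction j)
      case (Suc j)
      show ?case unfolding power_Suc
        by (rule monomial_span_mono[OF _ monomial_span_times[OF z0(2) Suc]])
          (auto simp: add elim!: set_plus_elim)
    qed (simp add: monomial_span_def w0)
    have "v \<notin> support (z0 ^ N)" for v
      using subsetD[of "support (z0 ^ N)" _ v] high low[of N]
      unfolding monomial_span_def by fastforce
    then have "support (z0 ^ N) = {}" by blast
    then have "z0 ^ N = 0" by simp
    with z0(1) show False by simp
  qed
  then show ?thesis
    using monomial_span_le_integral_closure[OF upS, where 'a='a]
    unfolding integrally_closed_def by blast
qed

section \<open>The generators and the standard monomials\<close>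

lemma monomial_extract:
  assumes "k \<le> expo u i"
  obtains v where "u = Poly_Mapping.single i k + v"
proof
  show "u = Poly_Mapping.single i k + (u - Poly_Mapping.single i k)"
    using assms by (intro poly_mapping_eqI) (auto simp: lookup_add lookup_minus lookup_single when_def)
qed

text \<open>The degree in the variables \<open>x\<^sub>1, \<dots>, x\<^bsub>n-1\<^esub>\<close>, which enter the initial ideal symmetrically up to
  the bound \<open>r\<close>.\<close>

definition inner_degree :: "nat \<Rightarrow> monomial \<Rightarrow> nat" where
  "inner_degree n u = (\<Sum>i\<in>{1..<n}. expo u i)"

lemma inner_degree_add: "inner_degree n (u + v) = inner_degree n u + inner_degree n v"
  by (simp add: inner_degree_def lookup_add sum.distrib)

lemma inner_degree_single:
  "inner_degree n (Poly_Mapping.single i k) = (if 1 \<le> i \<and> i < n then k else 0)"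
  by (simp add: inner_degree_def lookup_single when_def)

lemma inner_degree_extract:
  assumes "0 < inner_degree n u"
  obtains i v where "1 \<le> i" "i < n" "u = var i + v"
proof -
  obtain i where "i \<in> {1..<n}" "expo u i \<noteq> 0"
    using assms unfolding inner_degree_def by (metis less_numeral_extra(3) sum.neutral)
  then have "1 \<le> i" "i < n" "1 \<le> expo u i" by auto
  then show ?thesis
    using that monomial_extract[of 1 u i] by metis
qed

lemma inner_degree_extract2:
  assumes "2 \<le> inner_degree n u"
  obtains i j v where "1 \<le> i" "i < n" "1 \<le> j" "j < n" "u = var i + var j + v"
proof -
  have "0 < inner_degree n u" using assms by simp
  then obtain i v where i: "1 \<le> i" "i < n" "u = var i + v"
    by (rule inner_degree_extract)
  then have "0 < inner_degree n v"
    using assms by (simp add: inner_degree_add inner_degree_single)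
  then obtain j v' where "1 \<le> j" "j < n" "v = var j + v'"
    by (rule inner_degree_extract)
  with i show ?thesis
    using that by (simp add: add.assoc)
qed

lemma inner_degree_zeroD:
  assumes "u \<in> monomials n" "0 < n" "inner_degree n u = 0"
  shows "u = Poly_Mapping.single 0 (expo u 0) + Poly_Mapping.single n (expo u n)"
proof (rule poly_mapping_eqI)
  fix i
  have "expo u i = 0" if "0 < i" "i \<noteq> n"
    using that assms by (cases "i < n") (auto simp: inner_degree_def monomials_iff)
  then show "expo u i = expo (Poly_Mapping.single 0 (expo u 0) + Poly_Mapping.single n (expo u n)) i"
    using assms(2) by (auto simp: lookup_add lookup_single when_def)
qed

definition initial_gens :: "nat \<Rightarrow> nat \<Rightarrow> nat \<Rightarrow> monomial set" where
  "initial_gens n q r =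
     {var i + var j |i j. 1 \<le> i \<and> i < n \<and> 1 \<le> j \<and> j < n} \<union>
     {Poly_Mapping.single n q + var j |j. r \<le> j \<and> j \<le> n}"

definition initial_exponents :: "nat \<Rightarrow> nat \<Rightarrow> nat \<Rightarrow> monomial set" where
  "initial_exponents n q r = initial_gens n q r + monomials n"

lemma initial_gens_monomials: "initial_gens n q r \<subseteq> monomials n"
  by (auto simp: initial_gens_def monomials_add_iff intro!: var_in_monomials)

lemma upset_initial_exponents: "upset n (initial_exponents n q r)"
  unfolding initial_exponents_def by (intro upset_generated initial_gens_monomials)

lemma initial_exponents_quadratic:
  assumes "1 \<le> i" "i < n" "1 \<le> j" "j < n" "v \<in> monomials n"
  shows "var i + var j + v \<in> initial_exponents n q r"
  unfolding initial_exponents_def using assms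
  by (intro set_plus_intro) (auto simp: initial_gens_def)

lemma initial_exponents_last:
  assumes "r \<le> j" "j \<le> n" "v \<in> monomials n"
  shows "Poly_Mapping.single n q + var j + v \<in> initial_exponents n q r"
  unfolding initial_exponents_def using assms
  by (intro set_plus_intro) (auto simp: initial_gens_def)

lemma initial_exponents_elim:
  assumes "u \<in> initial_exponents n q r"
  obtains (quadratic) i j v where "1 \<le> i" "i < n" "1 \<le> j" "j < n" "v \<in> monomials n"
      "u = var i + var j + v"
    | (last) j v where "r \<le> j" "j \<le> n" "v \<in> monomials n" "u = Poly_Mapping.single n q + var j + v"
  using assms unfolding initial_exponents_def
  by (elim set_plus_elim) (auto simp: initial_gens_def)

text \<open>The shape of the monomials outside the initial ideal. The value \<open>j = 0\<close> encodes that no inner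
  variable occurs, so that the weighted degree depends on \<open>b n + j\<close> uniformly.\<close>

definition standard_monomial :: "nat \<Rightarrow> nat \<Rightarrow> nat \<Rightarrow> nat \<Rightarrow> monomial" where
  "standard_monomial n a b j =
     Poly_Mapping.single 0 a + Poly_Mapping.single n b + (if j = 0 then 0 else var j)"

text \<open>Avoiding the quadratic generators leaves at most one inner variable, and avoiding
  \<open>x\<^sub>n\<^bsup>q\<^esup> x\<^sub>j\<close> for \<open>j \<ge> r\<close> bounds \<open>b n + j\<close> by \<open>q n + r\<close>, which is \<open>m\<^sub>0\<close> in the application.\<close>

lemma not_initial_imp_standard:
  assumes u: "u \<in> monomials n" "u \<notin> initial_exponents n q r" and r: "1 \<le> r" "r \<le> n"
  obtains a b j where "j < n" "b * n + j < q * n + r" "u = standard_monomial n a b j"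
proof -
  have inner: "inner_degree n u < 2"
  proof (rule ccontr)
    assume "\<not> ?thesis"
    then have "2 \<le> inner_degree n u" by simp
    then obtain i j v where "1 \<le> i" "i < n" "1 \<le> j" "j < n" and v: "u = var i + var j + v"
      by (rule inner_degree_extract2)
    then show False
      using u initial_exponents_quadratic[of i n j v] by (simp add: monomials_add_iff)
  qed
  have le_q: "expo u n \<le> q"
  proof (rule ccontr)
    assume "\<not> ?thesis"
    then have "Suc q \<le> expo u n" by simp
    then obtain v where v: "u = Poly_Mapping.single n (Suc q) + v"
      by (rule monomial_extract)
    then have "u = Poly_Mapping.single n q + var n + v"
      by (simp flip: single_add)
    then show False
      using u r initial_exponents_last[of r n n v q] by (simp add: monomials_add_iff)
  qed
  show ?thesis
  proof (cases "inner_degree n u = 0")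
    case True
    then have "u = standard_monomial n (expo u 0) (expo u n) 0"
      using inner_degree_zeroD[of u n] u r by (simp add: standard_monomial_def)
    moreover have "expo u n * n \<le> q * n" using le_q by simp
    ultimately show ?thesis using that[of 0 "expo u n" "expo u 0"] r by linarith
  next
    case False
    then have "0 < inner_degree n u" by simp
    then obtain j v where j: "1 \<le> j" "j < n" and v: "u = var j + v"
      by (rule inner_degree_extract)
    have "v \<in> monomials n" using u v by (simp add: monomials_add_iff)
    moreover have "inner_degree n v = 0"
      using inner j by (simp add: v inner_degree_add inner_degree_single)
    ultimately have v': "v = Poly_Mapping.single 0 (expo v 0) + Poly_Mapping.single n (expo v n)"
      using r by (intro inner_degree_zeroD) auto
    have eq: "expo u n = expo v n"
      using j by (simp add: v lookup_add lookup_single)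
    have std: "u = standard_monomial n (expo v 0) (expo v n) j"
      using j v v' by (simp add: standard_monomial_def add.commute)
    have "expo v n * n + j < q * n + r"
    proof (cases "expo v n < q")
      case True
      then have "Suc (expo v n) * n \<le> q * n" by (intro mult_right_mono) auto
      then show ?thesis using j by simp
    next
      case False
      then have q: "expo v n = q" using le_q eq by simp
      have "j < r"
      proof (rule ccontr)
        assume "\<not> j < r"
        moreover have "u = Poly_Mapping.single n q + var j + Poly_Mapping.single 0 (expo v 0)"
          unfolding v by (subst v') (simp add: q ac_simps)
        ultimately show False
          using u j initial_exponents_last[of r j n "Poly_Mapping.single 0 (expo v 0)" q]
          by (simp add: var_in_monomials)
      qed
      then show ?thesis using q by simp
    qed
    with std j show ?thesis using that by blast
  qed
qed

section \<open>The initial ideal\<close>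

lemma wdeg_zero: "wdeg m 0 = 0"
  by (simp add: wdeg_def)

lemma wdeg_single: "wdeg m (Poly_Mapping.single i k) = k * m i"
  by (subst wdeg_superset[of "{i}"]) auto

text \<open>Within one weighted degree, grevlex is the reverse of the lexicographic order on finitely
  supported functions. Least monomials for grevlex are therefore maxima for a linear order that
  is compatible with addition.\<close>

lemma grevlex_less_same_wdeg:
  assumes "wdeg m u = wdeg m v"
  shows "grevlex_less m u v \<longleftrightarrow> v < u"
  using assms by (auto simp: grevlex_less_def less_poly_mapping.rep_eq less_fun_def)

lemma lex_less_if_vanishes_below:
  assumes "0 < expo h k" "\<And>i. i \<le> k \<Longrightarrow> expo g i = 0"
  shows "g < (h :: monomial)"
proof -
  define k0 where "k0 = (LEAST i. 0 < expo h i)"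
  have "0 < expo h k0" "k0 \<le> k"
    unfolding k0_def using assms(1) by (auto intro: LeastI Least_le)
  moreover have "expo h i = 0" if "i < k0" for i
    using not_less_Least[of i "\<lambda>i. 0 < expo h i"] that by (simp add: k0_def)
  ultimately show ?thesis
    unfolding less_poly_mapping.rep_eq less_fun_def
    by (intro exI[of _ k0]) (auto simp: assms(2))
qed

lemma finite_monomials_of_wdeg:
  assumes "\<And>i. i \<le> n \<Longrightarrow> 0 < m i"
  shows "finite {u \<in> monomials n. wdeg m u = W}"
proof -
  let ?B = "{f :: nat \<Rightarrow> nat. \<forall>i. (i \<in> {0..n} \<longrightarrow> f i \<in> {0..W}) \<and> (i \<notin> {0..n} \<longrightarrow> f i = 0)}"
  have "expo u i \<le> W" if u: "u \<in> monomials n" "wdeg m u = W" and i: "i \<le> n" for u i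
  proof -
    have "expo u i \<le> expo u i * m i" using assms[OF i] by simp
    also have "\<dots> \<le> (\<Sum>i\<in>{0..n}. expo u i * m i)"
      using i by (intro member_le_sum) auto
    also have "\<dots> = W"
      using u wdeg_superset[of "{0..n}" u m] by (simp add: monomials_def)
    finally show ?thesis .
  qed
  then have "expo ` {u \<in> monomials n. wdeg m u = W} \<subseteq> ?B"
    by (auto simp: monomials_iff)
  moreover have "finite ?B" by (rule finite_set_of_finite_funs) auto
  ultimately have "finite (expo ` {u \<in> monomials n. wdeg m u = W})"
    by (rule finite_subset)
  then show ?thesis
    by (rule finite_imageD) (simp add: inj_on_def flip: poly_mapping_eq_iff)
qed

text \<open>The binomial is \<open>x\<^sup>u - x\<^sup>h\<close>; equal weighted degrees put it into the kernel.\<close>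

lemma leading_monomial_of_binomial:
  assumes "u \<in> monomials n" "h \<in> monomials n" "wdeg m h = wdeg m u" "u < h"
  shows "\<exists>p \<in> (defining_ideal n m :: 'a::field mpoly set). p \<noteq> 0 \<and> is_leading_monomial m p u"
proof -
  define p :: "'a mpoly" where "p = Poly_Mapping.single u 1 + Poly_Mapping.single h (- 1)"
  have keys: "support p = {u, h}"
    using assms(4) by (auto simp: p_def in_keys_iff lookup_add lookup_single when_def split: if_splits)
  have "param_hom m p = monom 1 (wdeg m u) + monom (- 1) (wdeg m u)"
    by (simp add: p_def param_hom_add param_hom_single assms(3))
  also have "\<dots> = 0" by (simp add: add_monom)
  finally have "p \<in> defining_ideal n m"
    using assms(1,2) by (simp add: defining_ideal_def monomial_span_def keys)
  moreover have "is_leading_monomial m p u"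
    using assms(3,4) by (auto simp: is_leading_monomial_def keys grevlex_less_same_wdeg)
  moreover have "p \<noteq> 0" using keys by auto
  ultimately show ?thesis by blast
qed

text \<open>The coefficients of an element of the kernel that belong to one weighted degree add up to
  zero, so the leading monomial is not the only one of its degree.\<close>

lemma leading_monomial_not_maximal:
  fixes p :: "'a::field mpoly"
  assumes "p \<in> defining_ideal n m" "is_leading_monomial m p u"
  obtains v where "v \<in> monomials n" "wdeg m v = wdeg m u" "u < v"
proof -
  have u: "u \<in> support p" and lead: "\<And>v. v \<in> support p \<Longrightarrow> v \<noteq> u \<Longrightarrow> grevlex_less m v u"
    using assms(2) by (auto simp: is_leading_monomial_def)
  have "\<exists>v \<in> support p. v \<noteq> u \<and> wdeg m v = wdeg m u"
  proof (rule ccontr)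
    assume neg: "\<not> ?thesis"
    have "0 = coeff (param_hom m p) (wdeg m u)"
      using assms(1) by (simp add: defining_ideal_def)
    also have "\<dots> = (\<Sum>v\<in>support p. if wdeg m v = wdeg m u then Poly_Mapping.lookup p v else 0)"
      by (simp add: param_hom_superset[OF finite_keys order_refl] coeff_sum)
    also have "\<dots> = (\<Sum>v\<in>support p. if v = u then Poly_Mapping.lookup p v else 0)"
      using neg by (intro sum.cong) auto
    also have "\<dots> = Poly_Mapping.lookup p u" using u by simp
    finally show False using u by (simp add: in_keys_iff)
  qed
  then obtain v where v: "v \<in> support p" "v \<noteq> u" "wdeg m v = wdeg m u" by blast
  moreover have "v \<in> monomials n"
    using v assms(1) by (auto simp: defining_ideal_def monomial_span_def)
  ultimately show ?thesis
    using that lead grevlex_less_same_wdeg by blast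
qed

text \<open>Coprimality of \<open>m 0\<close> and \<open>d\<close> is the gcd condition on the sequence, and \<open>1 \<le> q\<close> is what minimality
  of the generators amounts to, as it says that \<open>n < m 0\<close>.\<close>

locale arithmetic_sequence =
  fixes n d q r :: nat and m :: "nat \<Rightarrow> nat"
  assumes n: "2 \<le> n"
    and m_eq: "\<And>i. i \<le> n \<Longrightarrow> m i = m 0 + i * d"
    and coprime: "coprime (m 0) d"
    and m0: "m 0 = q * n + r" and r: "1 \<le> r" "r \<le> n" and q: "1 \<le> q"
begin

lemma wdeg_standard:
  assumes "j < n"
  shows "wdeg m (standard_monomial n a b j) =
    (a + b + (if j = 0 then 0 else 1)) * m 0 + (b * n + j) * d"
  using assms by (cases "j = 0")
    (simp_all add: standard_monomial_def wdeg_add wdeg_zero wdeg_single m_eq[of n] m_eq[of j]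
      algebra_simps)

text \<open>Modulo \<open>m\<^sub>0\<close> the weighted degree of \<open>x\<^sub>0\<^bsup>a\<^esup> x\<^sub>n\<^bsup>b\<^esup> x\<^sub>j\<close> is \<open>(b n + j) d\<close>. As \<open>d\<close> is invertible
  modulo \<open>m\<^sub>0\<close> and \<open>b n + j < m\<^sub>0\<close>, the degree determines \<open>b n + j\<close>, hence \<open>b\<close> and \<open>j < n\<close> as
  quotient and remainder, and then \<open>a\<close>.\<close>

lemma standard_unique:
  assumes "u \<in> monomials n - initial_exponents n q r" "v \<in> monomials n - initial_exponents n q r"
    and eq: "wdeg m u = wdeg m v"
  shows "u = v"
proof -
  obtain a b j where u: "j < n" "b * n + j < m 0" "u = standard_monomial n a b j"
    unfolding m0 using assms(1) r by (auto elim: not_initial_imp_standard)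
  obtain a' b' j' where v: "j' < n" "b' * n + j' < m 0" "v = standard_monomial n a' b' j'"
    unfolding m0 using assms(2) r by (auto elim: not_initial_imp_standard)
  have "[(b * n + j) * d = (b' * n + j') * d] (mod m 0)"
  proof -
    have "(b * n + j) * d mod m 0 = wdeg m u mod m 0"
      using u by (simp add: wdeg_standard)
    also have "\<dots> = (b' * n + j') * d mod m 0"
      using v by (simp add: eq wdeg_standard)
    finally show ?thesis by (simp add: cong_def)
  qed
  then have "[b * n + j = b' * n + j'] (mod m 0)"
    using coprime by (simp add: cong_mult_rcancel_nat coprime_commute)
  then have *: "b * n + j = b' * n + j'"
    using u v by (simp add: cong_def)
  have "b = (b * n + j) div n" "b' = (b' * n + j') div n" "j = (b * n + j) mod n"
    "j' = (b' * n + j') mod n"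
    using u v by auto
  then have bj: "b = b'" "j = j'" using * by auto
  have "0 < m 0" using m0 r by simp
  then have "a = a'"
    using eq u v bj by (auto simp: wdeg_standard)
  then show ?thesis using bj u v by simp
qed

lemma m_pos: "i \<le> n \<Longrightarrow> 0 < m i"
  using m0 r by (subst m_eq) auto

text \<open>The binomials are \<open>x\<^sub>i x\<^sub>j - x\<^sub>0 x\<^bsub>i+j\<^esub>\<close> or \<open>x\<^sub>i x\<^sub>j - x\<^bsub>i+j-n\<^esub> x\<^sub>n\<close>, according to whether
  \<open>i + j \<le> n\<close>, and \<open>x\<^sub>n\<^bsup>q\<^esup> x\<^sub>j - x\<^sub>0\<^bsup>q+d\<^esup> x\<^bsub>j-r\<^esub>\<close>. The last one is homogeneous because
  \<open>q n d + r d = d m\<^sub>0\<close>. In each case the second monomial contains a variable of smaller index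
  than all variables of the first.\<close>

lemma generator_reduces:
  assumes "g \<in> initial_gens n q r"
  obtains h where "h \<in> monomials n" "wdeg m h = wdeg m g" "g < h"
  using assms unfolding initial_gens_def
proof (elim UnE CollectE exE conjE)
  fix i j assume g: "g = var i + var j" and ij: "1 \<le> i" "i < n" "1 \<le> j" "j < n"
  show thesis
  proof (cases "i + j \<le> n")
    case True
    show thesis
    proof (rule that)
      show "g < var 0 + var (i + j)"
        using ij by (intro lex_less_if_vanishes_below[of _ 0])
          (auto simp: g lookup_add lookup_single)
    qed (use True ij in \<open>auto simp: g monomials_add_iff var_in_monomials wdeg_add wdeg_single
        m_eq[of i] m_eq[of j] m_eq[of "i + j"] algebra_simps\<close>)
  next
    case False
    then have "(i + j - n) * d + n * d = i * d + j * d"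
      by (simp flip: add_mult_distrib)
    then have "m (i + j - n) + m n = m i + m j"
      using ij by (simp add: m_eq[of i] m_eq[of j] m_eq[of "i + j - n"] m_eq[of n])
    moreover have "g < var (i + j - n) + var n"
      using ij False by (intro lex_less_if_vanishes_below[of _ "i + j - n"])
        (auto simp: g lookup_add lookup_single when_def)
    ultimately show thesis
      using that[of "var (i + j - n) + var n"] ij
      by (auto simp: g monomials_add_iff var_in_monomials wdeg_add wdeg_single)
  qed
next
  fix j assume g: "g = Poly_Mapping.single n q + var j" and j: "r \<le> j" "j \<le> n"
  let ?h = "Poly_Mapping.single 0 (q + d) + var (j - r)"
  have "(j - r) * d + r * d = j * d"
    using j by (simp flip: add_mult_distrib)
  moreover have "d * m 0 = q * (n * d) + r * d"
    by (simp add: m0 algebra_simps)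
  moreover have "(q + d) * m 0 = q * m 0 + d * m 0" "q * m n = q * m 0 + q * (n * d)"
    by (simp_all add: m_eq[of n] algebra_simps)
  moreover have "m j = m 0 + j * d" "m (j - r) = m 0 + (j - r) * d"
    using j by (auto intro: m_eq)
  ultimately have "(q + d) * m 0 + m (j - r) = q * m n + m j"
    by linarith
  moreover have "g < ?h"
    using j q n r by (intro lex_less_if_vanishes_below[of _ 0])
      (auto simp: g lookup_add lookup_single when_def)
  ultimately show thesis
    using that[of ?h] j
    by (auto simp: g monomials_add_iff var_in_monomials wdeg_add wdeg_single)
qed

lemma initial_exponent_reduces:
  assumes "u \<in> initial_exponents n q r"
  obtains h where "h \<in> monomials n" "wdeg m h = wdeg m u" "u < h"
proof -
  obtain g v where u: "u = g + v" "g \<in> initial_gens n q r" "v \<in> monomials n"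
    using assms unfolding initial_exponents_def by (rule set_plus_elim)
  obtain h where "h \<in> monomials n" "wdeg m h = wdeg m g" "g < h"
    using u(2) by (rule generator_reduces)
  then show ?thesis
    using that[of "h + v"] u by (simp add: monomials_add_iff wdeg_add)
qed

text \<open>The least monomial of a weighted degree cannot be reduced, so it lies outside, and it is the
  only one of its degree that does.\<close>

lemma initial_exponent_iff:
  assumes "u \<in> monomials n"
  shows "u \<in> initial_exponents n q r \<longleftrightarrow> (\<exists>h \<in> monomials n. wdeg m h = wdeg m u \<and> u < h)"
proof
  assume "u \<in> initial_exponents n q r"
  then show "\<exists>h \<in> monomials n. wdeg m h = wdeg m u \<and> u < h"
    by (rule initial_exponent_reduces) blast
next
  assume "\<exists>h \<in> monomials n. wdeg m h = wdeg m u \<and> u < h"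
  then obtain h where h: "h \<in> monomials n" "wdeg m h = wdeg m u" "u < h" by blast
  let ?A = "{v \<in> monomials n. wdeg m v = wdeg m u}"
  have fin: "finite ?A" by (rule finite_monomials_of_wdeg) (rule m_pos)
  define t where "t = Max ?A"
  have t: "t \<in> monomials n" "wdeg m t = wdeg m u"
    using Max_in[OF fin] h unfolding t_def by auto
  have le: "v \<le> t" if "v \<in> monomials n" "wdeg m v = wdeg m t" for v
    unfolding t_def using fin that t by (intro Max_ge) auto
  have "t \<notin> initial_exponents n q r"
    using initial_exponent_reduces[of t] le by (metis leD)
  moreover have "u \<noteq> t" using le[of h] h t by auto
  ultimately show "u \<in> initial_exponents n q r"
    using standard_unique[of u t] assms t by auto
qed

lemma initial_ideal_eq:
  "initial_ideal n m (defining_ideal n m) =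
    (monomial_span (initial_exponents n q r) :: 'a::field mpoly set)"
proof -
  define L where "L = {u. \<exists>p \<in> (defining_ideal n m :: 'a mpoly set). p \<noteq> 0 \<and> is_leading_monomial m p u}"
  have L: "L \<subseteq> monomials n"
    by (auto simp: L_def defining_ideal_def monomial_span_def is_leading_monomial_def)
  have "L = initial_exponents n q r"
  proof
    show "L \<subseteq> initial_exponents n q r"
    proof
      fix u assume u: "u \<in> L"
      then obtain p :: "'a mpoly" where "p \<in> defining_ideal n m" "is_leading_monomial m p u"
        by (auto simp: L_def)
      then obtain v where "v \<in> monomials n" "wdeg m v = wdeg m u" "u < v"
        by (rule leading_monomial_not_maximal)
      then show "u \<in> initial_exponents n q r"
        using u L initial_exponent_iff by blast
    qed
    show "initial_exponents n q r \<subseteq> L"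
    proof
      fix u assume u: "u \<in> initial_exponents n q r"
      then have "u \<in> monomials n"
        using upset_initial_exponents upset_def by blast
      with u show "u \<in> L"
        unfolding L_def using initial_exponent_iff leading_monomial_of_binomial by blast
    qed
  qed
  moreover have "initial_ideal n m (defining_ideal n m) = (monomial_span (L + monomials n) :: 'a mpoly set)"
    using ideal_generated_by_monomials[OF L, where 'a='a] by (simp add: initial_ideal_def L_def)
  ultimately show ?thesis
    using upset_add_absorb[OF upset_initial_exponents] by simp
qed

end

section \<open>Powers of the initial ideal\<close>

text \<open>The witness is \<open>x\<^sub>1\<^bsup>2l-1\<^esup> x\<^sub>n\<^bsup>k\<^esup>\<close>. By the conditions on \<open>k\<close>, the only
  generator in \<open>x\<^sub>1\<close> and \<open>x\<^sub>n\<close> of degree at most \<open>k\<close> in \<open>x\<^sub>n\<close> is \<open>x\<^sub>1\<^sup>2\<close>, which keeps the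
  witness out of the power; and \<open>x\<^sub>n\<^bsup>2k\<^esup>\<close> is a multiple of \<open>x\<^sub>n\<^bsup>q+1\<^esup>\<close>, which makes it integral.\<close>

lemma powers_not_integrally_closed:
  assumes n: "2 \<le> n" and k: "k \<le> q" "r = 1 \<Longrightarrow> k < q" "Suc q \<le> 2 * k" and r: "1 \<le> r" "r \<le> n"
    and l: "0 < l"
  shows "\<not> integrally_closed (mpoly_ring n)
    (monomial_span (upset_power n (initial_exponents n q r) l) :: 'a::field mpoly set)"
proof
  let ?S = "initial_exponents n q r"
  let ?T = "upset_power n ?S"
  assume closed: "integrally_closed (mpoly_ring n) (monomial_span (?T l) :: 'a mpoly set)"
  define u where "u = Poly_Mapping.single 1 (2 * l - 1) + Poly_Mapping.single n k"
  \<comment> \<open>Each of the \<open>j\<close> factors of a monomial in \<open>x\<^sub>1\<close> and \<open>x\<^sub>n\<close> with so small a power of \<open>x\<^sub>n\<close>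
    must be a multiple of \<open>x\<^sub>1\<^sup>2\<close>.\<close>
  have "2 * j \<le> expo v 1"
    if "v \<in> ?T j" "\<And>i. i \<noteq> 1 \<Longrightarrow> i \<noteq> n \<Longrightarrow> expo v i = 0" "expo v n \<le> k" for v j
    using that
  proof (induction j arbitrary: v)
    case (Suc j)
    obtain v1 s where v: "v = v1 + s" "v1 \<in> ?T j" "s \<in> ?S"
      using Suc.prems(1) by (auto elim: set_plus_elim)
    have "2 * j \<le> expo v1 1"
      using Suc.prems(2,3) by (intro Suc.IH v) (simp_all add: v lookup_add)
    moreover have "2 \<le> expo s 1"
      using \<open>s \<in> ?S\<close>
    proof (cases rule: initial_exponents_elim)
      case (quadratic i i' s')
      then have "0 < expo v i" "0 < expo v i'"
        by (simp_all add: v lookup_add)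
      then have "i = 1" "i' = 1"
        using Suc.prems(2)[of i] Suc.prems(2)[of i'] quadratic by auto
      then show ?thesis by (simp add: quadratic lookup_add)
    next
      case (last i s')
      then have "0 < expo v i" by (simp add: v lookup_add)
      then have "i = 1 \<or> i = n" using Suc.prems(2)[of i] by auto
      moreover have "i \<noteq> n" "r \<noteq> 1"
        using Suc.prems(3) k(1,2) last by (auto simp: v lookup_add)
      ultimately show ?thesis using last r by simp
    qed
    ultimately show ?case by (simp add: v lookup_add)
  qed simp
  from this[of u l] have notin: "u \<notin> ?T l"
    using n l by (auto simp: u_def lookup_add lookup_single)
  have up: "upset n (?T j)" for j
    by (intro upset_power_upset upset_initial_exponents)
  have square: "Poly_Mapping.single 1 (2 * j) \<in> ?T j" for j
  proof (induction j)
    case (Suc j)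
    have "var 1 + var 1 + 0 \<in> ?S"
      using n by (intro initial_exponents_quadratic zero_in_monomials) auto
    then have "Poly_Mapping.single 1 (2 * j) + (var 1 + var 1) \<in> ?T (Suc j)"
      using Suc by auto
    then show ?case by (simp flip: single_add)
  qed (simp add: zero_in_monomials)
  obtain l' where l': "l = Suc l'" using l by (cases l) auto
  have "Poly_Mapping.single n q + var n + Poly_Mapping.single n (2 * k - Suc q) \<in> ?S"
    using r by (intro initial_exponents_last var_in_monomials) auto
  then have "Poly_Mapping.single n (2 * k) \<in> ?S"
    using k(3) by (simp flip: single_add)
  then have "Poly_Mapping.single 1 (2 * l') + Poly_Mapping.single n (2 * k) \<in> ?T l"
    using square[of l'] l' by auto
  then have "Poly_Mapping.single 1 (2 * l) + (Poly_Mapping.single 1 (2 * l') + Poly_Mapping.single n (2 * k))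
      \<in> ?T l + ?T l"
    using square[of l] by (intro set_plus_intro)
  moreover have "Poly_Mapping.single 1 (2 * l) + (Poly_Mapping.single 1 (2 * l') + Poly_Mapping.single n (2 * k))
      = u + u"
    by (intro poly_mapping_eqI) (auto simp: u_def l' lookup_add lookup_single when_def)
  moreover have "u \<in> monomials n"
    using n by (simp add: u_def monomials_add_iff var_in_monomials)
  ultimately have "monomial_poly u \<in> integral_closure (mpoly_ring n) (monomial_span (?T l) :: 'a mpoly set)"
    using monomial_in_integral_closure[OF up] by simp
  then have "monomial_poly u \<in> (monomial_span (?T l) :: 'a mpoly set)"
    using closed by (simp add: integrally_closed_def)
  with notin show False by (simp add: monomial_poly_def monomial_span_def)
qed

text \<open>The linear form that is constant on the segment from \<open>x\<^sub>1\<^sup>2\<close> to \<open>x\<^sub>n\<^bsup>q+1\<^esup>\<close>, where its value is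
  \<open>2 (q + 1)\<close>.\<close>

definition newton_weight :: "nat \<Rightarrow> nat \<Rightarrow> monomial \<Rightarrow> nat" where
  "newton_weight n q u = Suc q * inner_degree n u + 2 * expo u n"

lemma newton_weight_add: "newton_weight n q (u + v) = newton_weight n q u + newton_weight n q v"
  by (simp add: newton_weight_def inner_degree_add lookup_add algebra_simps)

lemma initial_exponents_newton_weight:
  assumes "u \<in> initial_exponents n q 1" "1 \<le> q"
  shows "2 * Suc q \<le> newton_weight n q u"
  using assms(1)
proof (cases rule: initial_exponents_elim)
  case (quadratic i j v)
  then show ?thesis
    by (simp add: newton_weight_def inner_degree_add inner_degree_single lookup_add)
next
  case (last j v)
  then show ?thesis using assms(2)
    by (cases "j = n") (simp_all add: newton_weight_def inner_degree_add inner_degree_single lookup_add)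
qed

text \<open>A greedy step: of a monomial heavy enough for the power \<open>l + 1\<close> one splits off a monomial of
  the ideal so that the rest is heavy enough for the power \<open>l\<close>. Splitting off \<open>x\<^sub>i x\<^sub>j\<close> or
  \<open>x\<^sub>n\<^bsup>q+1\<^esup>\<close> loses exactly \<open>2 (q + 1)\<close>. If the inner degree is \<open>1\<close>, splitting off
  \<open>x\<^sub>n\<^bsup>q\<^esup> x\<^sub>j\<close> loses more, and one has to use that exponents are integers.\<close>

lemma newton_weight_extract:
  assumes u: "u \<in> monomials n" "2 * Suc q * Suc l \<le> newton_weight n q u"
    and q: "1 \<le> q" "q \<le> 2" and n: "2 \<le> n"
  obtains s v where "s \<in> initial_exponents n q 1" "v \<in> monomials n" "u = v + s"
    "2 * Suc q * l \<le> newton_weight n q v"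
proof -
  consider "2 \<le> inner_degree n u" | "inner_degree n u = 0" | "inner_degree n u = 1"
    by linarith
  then show ?thesis
  proof cases
    case 1
    then obtain i j v where ij: "1 \<le> i" "i < n" "1 \<le> j" "j < n" and v: "u = var i + var j + v"
      by (rule inner_degree_extract2)
    have s: "var i + var j + 0 \<in> initial_exponents n q 1"
      by (intro initial_exponents_quadratic ij zero_in_monomials)
    have "newton_weight n q (var i + var j) = 2 * Suc q"
      using ij by (simp add: newton_weight_def inner_degree_add inner_degree_single lookup_add lookup_single)
    then show ?thesis
      using that[of "var i + var j" v] s u v
      by (simp add: newton_weight_add monomials_add_iff add.commute)
  next
    case 2
    then have "Suc q * Suc l \<le> expo u n" using u(2) by (simp add: newton_weight_def)
    then have "Suc q \<le> expo u n" by simp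
    then obtain v where v: "u = Poly_Mapping.single n (Suc q) + v"
      by (rule monomial_extract)
    have "Poly_Mapping.single n q + var n + 0 \<in> initial_exponents n q 1"
      using n by (intro initial_exponents_last zero_in_monomials) auto
    then have s: "Poly_Mapping.single n (Suc q) \<in> initial_exponents n q 1"
      by (simp flip: single_add)
    have "newton_weight n q (Poly_Mapping.single n (Suc q)) = 2 * Suc q"
      by (simp add: newton_weight_def inner_degree_single)
    then show ?thesis
      using that[of "Poly_Mapping.single n (Suc q)" v] s u v
      by (simp add: newton_weight_add monomials_add_iff add.commute)
  next
    case 3
    then have "0 < inner_degree n u" by simp
    then obtain j w where j: "1 \<le> j" "j < n" and w: "u = var j + w"
      by (rule inner_degree_extract)
    have expo_w: "expo w n = expo u n" using j by (simp add: w lookup_add lookup_single)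
    have "2 * (Suc q * l) + Suc q \<le> 2 * expo u n"
      using u(2) 3 by (simp add: newton_weight_def)
    \<comment> \<open>Rounding up \<open>(q + 1) / 2\<close> gives at least \<open>q\<close> exactly when \<open>q \<le> 2\<close>.\<close>
    then have b: "q + Suc q * l \<le> expo u n" using q(2) by linarith
    then have "q \<le> expo w n" using expo_w by simp
    then obtain v where v: "w = Poly_Mapping.single n q + v"
      by (rule monomial_extract)
    have s: "Poly_Mapping.single n q + var j + 0 \<in> initial_exponents n q 1"
      using j by (intro initial_exponents_last zero_in_monomials) auto
    have "Suc q * l \<le> expo v n" using b expo_w v by (simp add: lookup_add)
    then have "2 * Suc q * l \<le> newton_weight n q v" by (simp add: newton_weight_def)
    then show ?thesis
      using that[of "Poly_Mapping.single n q + var j" v] s u v w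
      by (simp add: monomials_add_iff ac_simps)
  qed
qed

lemma upset_power_eq_weight:
  assumes q: "1 \<le> q" "q \<le> 2" and n: "2 \<le> n"
  shows "upset_power n (initial_exponents n q 1) l
    = {u \<in> monomials n. 2 * Suc q * l \<le> newton_weight n q u}"
proof (induction l)
  case (Suc l)
  show ?case
  proof (intro equalityI subsetI)
    fix u assume u: "u \<in> upset_power n (initial_exponents n q 1) (Suc l)"
    then obtain v s where vs: "u = v + s" "v \<in> upset_power n (initial_exponents n q 1) l"
      "s \<in> initial_exponents n q 1"
      by (auto elim: set_plus_elim)
    have "u \<in> monomials n"
      using u upset_power_upset[OF upset_initial_exponents] unfolding upset_def by blast
    then show "u \<in> {u \<in> monomials n. 2 * Suc q * Suc l \<le> newton_weight n q u}"
      using vs initial_exponents_newton_weight[OF vs(3) q(1)] Suc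
      by (simp add: newton_weight_add)
  next
    fix u assume "u \<in> {u \<in> monomials n. 2 * Suc q * Suc l \<le> newton_weight n q u}"
    then have "u \<in> monomials n" "2 * Suc q * Suc l \<le> newton_weight n q u" by simp_all
    then obtain s v where "s \<in> initial_exponents n q 1" "v \<in> monomials n" "u = v + s"
      "2 * Suc q * l \<le> newton_weight n q v"
      using newton_weight_extract q n by blast
    then show "u \<in> upset_power n (initial_exponents n q 1) (Suc l)"
      using Suc by auto
  qed
qed simp

lemma powers_integrally_closed_iff:
  assumes n: "2 \<le> n" and q: "1 \<le> q" and r: "1 \<le> r" "r \<le> n" and l: "0 < l"
  shows "integrally_closed (mpoly_ring n)
      (monomial_span (upset_power n (initial_exponents n q r) l) :: 'a::field mpoly set)
    \<longleftrightarrow> q \<le> 2 \<and> r = 1"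
proof
  assume "q \<le> 2 \<and> r = 1"
  then show "integrally_closed (mpoly_ring n)
      (monomial_span (upset_power n (initial_exponents n q r) l) :: 'a mpoly set)"
    using integrally_closed_weight_ideal[of "newton_weight n q", OF newton_weight_add[of n q]] n q
    by (simp only: upset_power_eq_weight)
next
  assume closed: "integrally_closed (mpoly_ring n)
      (monomial_span (upset_power n (initial_exponents n q r) l) :: 'a mpoly set)"
  show "q \<le> 2 \<and> r = 1"
  proof (rule ccontr)
    assume neg: "\<not> ?thesis"
    define k where "k = (if r = 1 then q - 1 else q)"
    have "k \<le> q" "r = 1 \<Longrightarrow> k < q" "Suc q \<le> 2 * k"
      using neg q by (auto simp: k_def)
    then show False
      using powers_not_integrally_closed[OF n _ _ _ r l, where 'a='a] closed by blast
  qed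
qed

text \<open>If \<open>m\<^sub>0 \<le> n\<close>, the term of the sequence with index \<open>m\<^sub>0\<close> is \<open>m\<^sub>0 + m\<^sub>0 d = (1 + d) m\<^sub>0\<close>, a redundant
  generator.\<close>

lemma minimally_generates_imp_less:
  assumes "\<And>i. i \<le> n \<Longrightarrow> m i = m 0 + i * d" "0 < m 0" "minimally_generates m n"
  shows "n < m 0"
proof (rule ccontr)
  assume "\<not> n < m 0"
  then have le: "m 0 \<le> n" by simp
  define k where "k = m 0"
  let ?J = "{0..n} - {k}"
  have k: "k \<in> {0..n}" "0 < k" "m k = (1 + d) * m 0"
    using le assms(1)[of k] assms(2) by (auto simp: k_def)
  have "generated_semigroup m ?J = generated_semigroup m {0..n}"
    unfolding generated_semigroup_def
  proof (intro equalityI subsetI)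
    fix x assume "x \<in> range (\<lambda>a. \<Sum>i\<in>?J. a i * m i)"
    then obtain a where x: "x = (\<Sum>i\<in>?J. a i * m i)" by blast
    have "(\<Sum>i\<in>{0..n}. (a(k := 0)) i * m i) = (a(k := 0)) k * m k + (\<Sum>i\<in>?J. (a(k := 0)) i * m i)"
      using k(1) by (intro sum.remove) auto
    also have "\<dots> = x" unfolding x by simp
    finally show "x \<in> range (\<lambda>a. \<Sum>i\<in>{0..n}. a i * m i)"
      by (intro range_eqI[of _ _ "a(k := 0)"]) (rule sym)
  next
    fix x assume "x \<in> range (\<lambda>a. \<Sum>i\<in>{0..n}. a i * m i)"
    then obtain a where x: "x = (\<Sum>i\<in>{0..n}. a i * m i)" by blast
    \<comment> \<open>Trade every copy of \<open>m k\<close> for \<open>1 + d\<close> copies of \<open>m 0\<close>.\<close>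
    define b where "b = a(0 := a 0 + a k * (1 + d))"
    have "x = a k * m k + (\<Sum>i\<in>?J. a i * m i)"
      unfolding x using k(1) by (intro sum.remove) auto
    also have "(\<Sum>i\<in>?J. a i * m i) = a 0 * m 0 + (\<Sum>i\<in>?J - {0}. a i * m i)"
      using k by (intro sum.remove) auto
    also have "(\<Sum>i\<in>?J - {0}. a i * m i) = (\<Sum>i\<in>?J - {0}. b i * m i)"
      by (intro sum.cong) (auto simp: b_def)
    also have "a k * m k + (a 0 * m 0 + (\<Sum>i\<in>?J - {0}. b i * m i))
        = b 0 * m 0 + (\<Sum>i\<in>?J - {0}. b i * m i)"
      by (simp add: k(3) b_def algebra_simps)
    also have "\<dots> = (\<Sum>i\<in>?J. b i * m i)"
      using k by (intro sum.remove[symmetric]) auto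
    finally show "x \<in> range (\<lambda>a. \<Sum>i\<in>?J. a i * m i)"
      by (intro range_eqI[of _ _ b])
  qed
  moreover have "?J \<subset> {0..n}" using k(1) by blast
  ultimately show False using assms(3) unfolding minimally_generates_def by simp
qed

theorem theorem22:
  fixes n d l :: nat and m :: "nat \<Rightarrow> nat" and q r :: int
    and P inP :: "'a::field mpoly set"
  assumes "n \<ge> 2"
    and "m 0 > 0" and "d > 0"
    and "\<And>i. i \<le> n \<Longrightarrow> m i = m 0 + i * d"
    and "Gcd (m ` {0..n}) = 1"
    and "minimally_generates m n"
    and "int (m 0) = q * int n + r" and "1 \<le> r" and "r \<le> int n"
    and "P = defining_ideal n m"
    and "inP = initial_ideal n m P"
    and "l > 0"
  shows "(integrally_closed (mpoly_ring n) (ideal_power (mpoly_ring n) inP l) \<longleftrightarrow> q \<le> 2 \<and> r = 1) \<and>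
         (normal_ideal (mpoly_ring n) inP \<longleftrightarrow> q \<le> 2 \<and> r = 1)"
proof -
  have "n < m 0"
    using assms(4,2,6) by (rule minimally_generates_imp_less)
  have "0 < q"
  proof (rule ccontr)
    assume "\<not> 0 < q"
    then have "q * int n \<le> 0" by (simp add: mult_nonpos_nonneg)
    then show False using \<open>n < m 0\<close> assms(7,9) by linarith
  qed
  define q' r' where "q' = nat q" and "r' = nat r"
  have qr: "q = int q'" "r = int r'" using \<open>0 < q\<close> assms(8) by (simp_all add: q'_def r'_def)
  have "gcd (m 0) d dvd Gcd (m ` {0..n})"
  proof (rule Gcd_greatest)
    fix x assume "x \<in> m ` {0..n}"
    then obtain i where i: "i \<le> n" "x = m i" by auto
    have "x = m 0 + i * d" using i(2) assms(4)[OF i(1)] by simp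
    then show "gcd (m 0) d dvd x" by simp
  qed
  then have cop: "coprime (m 0) d" using assms(5) by (simp add: coprime_iff_gcd_eq_1)
  have "int (m 0) = int (q' * n + r')"
    using assms(7) unfolding qr by simp
  then have m0: "m 0 = q' * n + r'" by (rule of_nat_eq_iff[THEN iffD1])
  have bounds: "1 \<le> r'" "r' \<le> n" "1 \<le> q'"
    using assms(8,9) \<open>0 < q\<close> unfolding qr by simp_all
  interpret arithmetic_sequence n d q' r' m
    by unfold_locales (fact assms(1) assms(4) cop m0 bounds)+
  have "inP = monomial_span (initial_exponents n q' r')"
    using assms(10,11) initial_ideal_eq by simp
  then have "integrally_closed (mpoly_ring n) (ideal_power (mpoly_ring n) inP k) \<longleftrightarrow> q \<le> 2 \<and> r = 1"
    if "0 < k" for k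
    using powers_integrally_closed_iff[OF \<open>n \<ge> 2\<close> bounds(3,1,2) that, where 'a='a]
    by (simp add: monomial_span_power qr)
  then show ?thesis
    using \<open>l > 0\<close> unfolding normal_ideal_def by (metis One_nat_def Suc_le_eq)
qed

end
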